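(* Let $F\in\{\widehat{\mathcal T},\widehat{\mathcal T}_{\rm lin}\}$ with $\gamma$ in the admissible range for $F$, let $\alpha>0$, $\beta\in(0,1)$, and set $$k^\star:=\left\lceil\frac{2}{\alpha\beta(1+\gamma)}\right\rceil .$$ Let $w_{0,0}\in\mathbb R^n\times\mathbb R^m$ and, for $n\ge0$, let $$w_{n,k+1}=\frac{1}{k+2}w_{n,0}+\frac{k+1}{k+2}\mathcal S_\gamma(w_{n,k})\quad(k\ge0),\qquad w_{n+1,0}:=w_{n,k^\star},$$ where $\mathcal S_\gamma:=(1+\gamma)F-\gamma I$. Assume that all iterates remain in a set $\mathcal K\subset\mathbb R^n\times\mathbb R^m$ on which $F$ satisfies the $\alpha$-sharpness condition $$\alpha\operatorname{dist}_{\mathcal M}(w,W^\star)\le\|w-F(w)\|_{\mathcal M}\qquad\forall w\in\mathcal K .$$ Then $$\operatorname{dist}_{\mathcal M}(w_{n,0},W^\star)\le\beta^n\operatorname{dist}_{\mathcal M}(w_{0,0},W^\star)\qquad\forall n\ge0 .$$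
   Context: Setting: $A\in\mathbb R^{m\times n}$, $b\in\mathbb R^m$, $\sigma\ge0$; $f:\mathbb R^n\to\mathbb R$ is convex and continuously differentiable with Lipschitz continuous gradient; $g:\mathbb R^n\to(-\infty,+\infty]$ is proper, closed and convex; $\Phi:=f+g$; $P\in\mathbb R^{n\times n}$, $Q\in\mathbb R^{m\times m}$ are self-adjoint positive semidefinite. Define $$\mathcal M=\begin{pmatrix} P & A^\top \\ A & Q \end{pmatrix},\qquad \mathcal T(x,y)=\begin{pmatrix} \nabla f(x)+\partial g(x)-A^\top y+\sigma A^\top(Ax-b) \\ Ax-b \end{pmatrix},\qquad W^\star:=\mathcal T^{-1}(0),$$ and assume $W^\star\ne\emptyset$. Notation: $\|w\|_{\mathcal M}=\sqrt{\langle w,\mathcal Mw\rangle}$ and $\operatorname{dist}_{\mathcal M}(w,S)=\inf_{u\in S}\|w-u\|_{\mathcal M}$ (a semidistance if $\mathcal M$ is singular). Exact map: $\widehat{\mathcal T}:=(\mathcal M+\mathcal T)^{-1}\mathcal M$, considered under the assumptions $Q\succ0$, $\mathcal M\succeq0$, and that $\partial\Phi+P+\sigma A^\top A$ has a single-valued globally Lipschitz inverse on $\mathbb R^n$. Admissible range: $\gamma\in(-1,1]$. Linearized map: $h:\mathbb R^n\to\mathbb R$ is convex and continuously differentiable with $L_h$-Lipschitz gradient, $f-h+\frac\sigma2\|A\cdot-b\|^2$ is convex, $Q\succ0$, $P-A^\top Q^{-1}A\succ0$, and $\mu_x:=\lambda_{\min}(P-A^\top Q^{-1}A)>L_h/2$;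 with $\mathcal B_h(x,y)=(\nabla h(x),0)$ and $\mathcal A_h:=\mathcal T-\mathcal B_h$, $\widehat{\mathcal T}_{\rm lin}(w):=(\mathcal M+\mathcal A_h)^{-1}(\mathcal Mw-\mathcal B_h(w))$. Admissible range: $\gamma\in(-1,1-L_h/(2\mu_x))$. In both cases the map is single-valued with full domain, its fixed-point set is $W^\star$, and $\mathcal S_\gamma$ is nonexpansive in $\|\cdot\|_{\mathcal M}$. *)

theory Defs
  imports "HOL-Analysis.Analysis"
begin

section \<open>Convex analysis\<close>

definition gradient :: "('a::real_inner \<Rightarrow> real) \<Rightarrow> 'a \<Rightarrow> 'a" where
  "gradient f x = (THE D. GDERIV f x :> D)"

text \<open>Continuity of the gradient is implied by its Lipschitz continuity.\<close>

definition convex_lipschitz_gradient :: "real \<Rightarrow> ('a::real_inner \<Rightarrow> real) \<Rightarrow> bool" where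
  "convex_lipschitz_gradient L f \<longleftrightarrow>
     convex_on UNIV f \<and> (\<forall>x. GDERIV f x :> gradient f x) \<and> L-lipschitz_on UNIV (gradient f)"

definition epi :: "('a \<Rightarrow> ereal) \<Rightarrow> ('a \<times> real) set" where
  "epi g = {(x, t). g x \<le> ereal t}"

definition proper_fun :: "('a \<Rightarrow> ereal) \<Rightarrow> bool" where
  "proper_fun g \<longleftrightarrow> (\<forall>x. g x \<noteq> -\<infinity>) \<and> (\<exists>x. g x \<noteq> \<infinity>)"

definition closed_fun :: "('a::topological_space \<Rightarrow> ereal) \<Rightarrow> bool" where
  "closed_fun g \<longleftrightarrow> closed (epi g)"

definition convex_fun :: "('a::real_vector \<Rightarrow> ereal) \<Rightarrow> bool" where
  "convex_fun g \<longleftrightarrow> convex (epi g)"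

text \<open>By convention the subdifferential is empty outside the effective domain.\<close>

definition subdiff :: "('a::real_inner \<Rightarrow> ereal) \<Rightarrow> 'a \<Rightarrow> 'a set" where
  "subdiff g x = {v. \<bar>g x\<bar> \<noteq> \<infinity> \<and> (\<forall>z. g x + ereal (inner v (z - x)) \<le> g z)}"

section \<open>Matrices and seminorms\<close>

definition pos_semidef :: "real ^ 'n ^ 'n \<Rightarrow> bool" where
  "pos_semidef B \<longleftrightarrow> transpose B = B \<and> (\<forall>x. 0 \<le> inner x (B *v x))"

definition pos_def :: "real ^ 'n ^ 'n \<Rightarrow> bool" where
  "pos_def B \<longleftrightarrow> transpose B = B \<and> (\<forall>x. x \<noteq> 0 \<longrightarrow> 0 < inner x (B *v x))"

definition lambda_min :: "real ^ 'n ^ 'n \<Rightarrow> real" where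
  "lambda_min B = (LEAST l. \<exists>v. v \<noteq> 0 \<and> B *v v = l *\<^sub>R v)"

definition schur_compl :: "real ^ 'n ^ 'n \<Rightarrow> real ^ 'm ^ 'm \<Rightarrow> real ^ 'n ^ 'm \<Rightarrow> real ^ 'n ^ 'n" where
  "schur_compl P Q A = P - transpose A ** matrix_inv Q ** A"

text \<open>The block matrix with rows \<open>(P, A\<^sup>T)\<close> and \<open>(A, Q)\<close>, acting on pairs.\<close>

definition block_op ::
  "real ^ 'n ^ 'n \<Rightarrow> real ^ 'm ^ 'm \<Rightarrow> real ^ 'n ^ 'm \<Rightarrow>
     (real ^ 'n) \<times> (real ^ 'm) \<Rightarrow> (real ^ 'n) \<times> (real ^ 'm)" where
  "block_op P Q A = (\<lambda>(x, y). (P *v x + transpose A *v y, A *v x + Q *v y))"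

definition snorm :: "('a::real_inner \<Rightarrow> 'a) \<Rightarrow> 'a \<Rightarrow> real" where
  "snorm M w = sqrt (inner w (M w))"

definition sdist :: "('a::real_inner \<Rightarrow> 'a) \<Rightarrow> 'a \<Rightarrow> 'a set \<Rightarrow> real" where
  "sdist M w S = (INF u\<in>S. snorm M (w - u))"

section \<open>The operators and the two maps\<close>

definition kkt_op ::
  "(real ^ 'n \<Rightarrow> real) \<Rightarrow> (real ^ 'n \<Rightarrow> ereal) \<Rightarrow> real ^ 'n ^ 'm \<Rightarrow> real ^ 'm \<Rightarrow> real \<Rightarrow>
     (real ^ 'n) \<times> (real ^ 'm) \<Rightarrow> ((real ^ 'n) \<times> (real ^ 'm)) set" where
  "kkt_op f g A b \<sigma> = (\<lambda>(x, y).
     {(gradient f x + v - transpose A *v y + \<sigma> *\<^sub>R (transpose A *v (A *v x - b)), A *v x - b)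
      | v. v \<in> subdiff g x})"

definition kkt_set ::
  "(real ^ 'n \<Rightarrow> real) \<Rightarrow> (real ^ 'n \<Rightarrow> ereal) \<Rightarrow> real ^ 'n ^ 'm \<Rightarrow> real ^ 'm \<Rightarrow> real \<Rightarrow>
     ((real ^ 'n) \<times> (real ^ 'm)) set" where
  "kkt_set f g A b \<sigma> = {w. 0 \<in> kkt_op f g A b \<sigma> w}"

text \<open>The set \<open>(M + T)\<^sup>-\<^sup>1 v\<close> for a single-valued \<open>M\<close> and a set-valued \<open>T\<close>.\<close>

definition sum_inverse :: "('a::plus \<Rightarrow> 'a) \<Rightarrow> ('a \<Rightarrow> 'a set) \<Rightarrow> 'a \<Rightarrow> 'a set" where
  "sum_inverse M T v = {u. \<exists>t\<in>T u. v = M u + t}"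

text \<open>
  Both maps below are set-valued by construction; under the respective assumptions their values
  are singletons, and \<^const>\<open>the_elem\<close> returns the unique element.
\<close>

definition exact_map ::
  "(real ^ 'n \<Rightarrow> real) \<Rightarrow> (real ^ 'n \<Rightarrow> ereal) \<Rightarrow> real ^ 'n ^ 'm \<Rightarrow> real ^ 'm \<Rightarrow> real \<Rightarrow>
     real ^ 'n ^ 'n \<Rightarrow> real ^ 'm ^ 'm \<Rightarrow>
     (real ^ 'n) \<times> (real ^ 'm) \<Rightarrow> (real ^ 'n) \<times> (real ^ 'm)" where
  "exact_map f g A b \<sigma> P Q w =
     the_elem (sum_inverse (block_op P Q A) (kkt_op f g A b \<sigma>) (block_op P Q A w))"

definition forward_op ::
  "(real ^ 'n \<Rightarrow> real) \<Rightarrow> (real ^ 'n) \<times> (real ^ 'm) \<Rightarrow> (real ^ 'n) \<times> (real ^ 'm)" where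
  "forward_op h = (\<lambda>(x, y). (gradient h x, 0))"

definition backward_op ::
  "(real ^ 'n \<Rightarrow> real) \<Rightarrow> (real ^ 'n \<Rightarrow> ereal) \<Rightarrow> real ^ 'n ^ 'm \<Rightarrow> real ^ 'm \<Rightarrow> real \<Rightarrow>
     (real ^ 'n \<Rightarrow> real) \<Rightarrow> (real ^ 'n) \<times> (real ^ 'm) \<Rightarrow> ((real ^ 'n) \<times> (real ^ 'm)) set" where
  "backward_op f g A b \<sigma> h w = (\<lambda>t. t - forward_op h w) ` kkt_op f g A b \<sigma> w"

definition linearized_map ::
  "(real ^ 'n \<Rightarrow> real) \<Rightarrow> (real ^ 'n \<Rightarrow> ereal) \<Rightarrow> real ^ 'n ^ 'm \<Rightarrow> real ^ 'm \<Rightarrow> real \<Rightarrow>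
     real ^ 'n ^ 'n \<Rightarrow> real ^ 'm ^ 'm \<Rightarrow> (real ^ 'n \<Rightarrow> real) \<Rightarrow>
     (real ^ 'n) \<times> (real ^ 'm) \<Rightarrow> (real ^ 'n) \<times> (real ^ 'm)" where
  "linearized_map f g A b \<sigma> P Q h w =
     the_elem (sum_inverse (block_op P Q A) (backward_op f g A b \<sigma> h)
                 (block_op P Q A w - forward_op h w))"

definition exact_assms ::
  "(real ^ 'n \<Rightarrow> real) \<Rightarrow> (real ^ 'n \<Rightarrow> ereal) \<Rightarrow> real ^ 'n ^ 'm \<Rightarrow> real \<Rightarrow>
     real ^ 'n ^ 'n \<Rightarrow> real ^ 'm ^ 'm \<Rightarrow> bool" where
  "exact_assms f g A \<sigma> P Q \<longleftrightarrow>
     pos_def Q \<and>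
     (\<forall>w. 0 \<le> inner w (block_op P Q A w)) \<and>
     (\<exists>R L. L-lipschitz_on UNIV R \<and>
        (\<forall>v. {x. \<exists>s\<in>subdiff (\<lambda>z. ereal (f z) + g z) x.
                   v = s + P *v x + \<sigma> *\<^sub>R (transpose A *v (A *v x))} = {R v}))"

definition linearized_assms ::
  "(real ^ 'n \<Rightarrow> real) \<Rightarrow> real ^ 'n ^ 'm \<Rightarrow> real ^ 'm \<Rightarrow> real \<Rightarrow>
     real ^ 'n ^ 'n \<Rightarrow> real ^ 'm ^ 'm \<Rightarrow> (real ^ 'n \<Rightarrow> real) \<Rightarrow> real \<Rightarrow> bool" where
  "linearized_assms f A b \<sigma> P Q h L\<^sub>h \<longleftrightarrow>
     convex_lipschitz_gradient L\<^sub>h h \<and>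
     convex_on UNIV (\<lambda>x. f x - h x + \<sigma> / 2 * (norm (A *v x - b))\<^sup>2) \<and>
     pos_def Q \<and>
     pos_def (schur_compl P Q A) \<and>
     lambda_min (schur_compl P Q A) > L\<^sub>h / 2"

definition relaxed :: "real \<Rightarrow> ('a::real_vector \<Rightarrow> 'a) \<Rightarrow> 'a \<Rightarrow> 'a" where
  "relaxed \<gamma> F w = (1 + \<gamma>) *\<^sub>R F w - \<gamma> *\<^sub>R w"

end

theory Submission
  imports Defs
begin

text \<open>
  Both maps are resolvents: a step solves an inclusion for \<open>x\<close> in which \<open>y\<close> cancels, after which
  \<open>y\<close> is read off from \<open>Q\<close>. The exact map is the linearized one for \<open>h = 0\<close>. Monotonicity of the
  backward operator and cocoercivity of \<open>\<nabla>h\<close> make the relaxed map \<open>S\<close> nonexpansive in the seminorm,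
  so the Halpern iteration satisfies \<open>\<parallel>w\<^sub>k - S w\<^sub>k\<parallel> \<le> 2/(k+1) \<parallel>w\<^sub>0 - z\<parallel>\<close> for each solution \<open>z\<close>. As
  \<open>w - S w = (1 + \<gamma>) (w - F w)\<close>, sharpness turns this into a contraction of the distance to the
  solution set by the factor \<open>\<beta>\<close> per restart.
\<close>

section \<open>Halpern iteration in a seminorm\<close>

text \<open>\<open>M\<close> may be singular, so \<open>ip\<close> is a possibly degenerate form and
  \<open>snorm M\<close> only a seminorm. The locale serves both the block operator and a symmetric
  matrix shifted by its smallest eigenvalue.\<close>

locale semi_inner =
  fixes M :: "'a::real_inner \<Rightarrow> 'a"
  assumes lin: "linear M"
    and sym: "inner u (M v) = inner v (M u)"
    and nonneg: "0 \<le> inner u (M u)"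
begin

abbreviation ip :: "'a \<Rightarrow> 'a \<Rightarrow> real" where "ip u v \<equiv> inner u (M v)"

lemmas ip_simps =
  linear_add[OF lin] linear_diff[OF lin] linear_scale[OF lin] linear_neg[OF lin]
  inner_add_left inner_add_right inner_diff_left inner_diff_right

lemma snorm_nonneg: "0 \<le> snorm M u"
  by (simp add: snorm_def nonneg)

lemma snorm_sq: "(snorm M u)\<^sup>2 = ip u u"
  by (simp add: snorm_def nonneg)

lemma ip_square: "ip (a *\<^sub>R u + c *\<^sub>R v) (a *\<^sub>R u + c *\<^sub>R v) = a\<^sup>2 * ip u u + 2 * a * c * ip u v + c\<^sup>2 * ip v v"
  using sym[of v u] by (simp add: ip_simps power2_eq_square algebra_simps)

lemma snorm_scale: "snorm M (c *\<^sub>R u) = \<bar>c\<bar> * snorm M u"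
proof -
  have "ip (c *\<^sub>R u) (c *\<^sub>R u) = c\<^sup>2 * ip u u"
    by (simp add: ip_simps power2_eq_square)
  then show ?thesis by (simp add: snorm_def real_sqrt_mult)
qed

lemma Cauchy_Schwarz_sq: "(ip u v)\<^sup>2 \<le> ip u u * ip v v"
proof -
  have *: "0 \<le> a\<^sup>2 * ip u u + 2 * a * c * ip u v + c\<^sup>2 * ip v v" for a c
    using nonneg[of "a *\<^sub>R u + c *\<^sub>R v"] unfolding ip_square .
  show ?thesis
  proof (cases "ip v v = 0")
    case True
    have "0 \<le> ip u u - 2 * t * (ip u v)\<^sup>2" for t
      using *[of 1 "- t * ip u v"] True by (simp add: power2_eq_square algebra_simps)
    \<comment> \<open>Were \<open>ip u v\<close> nonzero, this multiplier would make the inequality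
      read \<open>0 \<le> -1\<close>.\<close>
    from this[of "(ip u u + 1) / (2 * (ip u v)\<^sup>2)"] have "ip u v = 0"
      by (cases "ip u v = 0") (auto simp: field_simps)
    then show ?thesis using True by simp
  next
    case False
    with nonneg[of v] have pos: "0 < ip v v" by simp
    \<comment> \<open>The coefficients give the component of \<open>u\<close> orthogonal to
      \<open>v\<close>, scaled by \<open>ip v v\<close> to avoid a division.\<close>
    have "0 \<le> ip v v * (ip u u * ip v v - (ip u v)\<^sup>2)"
      using *[of "ip v v" "- ip u v"] by (simp add: power2_eq_square algebra_simps)
    then show ?thesis using pos by (simp add: zero_le_mult_iff)
  qed
qed

lemma Cauchy_Schwarz: "ip u v \<le> snorm M u * snorm M v"
proof -
  have "\<bar>ip u v\<bar> \<le> snorm M u * snorm M v"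
  proof (rule power2_le_imp_le)
    show "\<bar>ip u v\<bar>\<^sup>2 \<le> (snorm M u * snorm M v)\<^sup>2"
      using Cauchy_Schwarz_sq[of u v] by (simp add: power_mult_distrib snorm_sq)
  qed (simp add: snorm_nonneg)
  then show ?thesis by simp
qed

section \<open>Residuals of nonexpansive maps and the Halpern rate\<close>

text \<open>\<open>S x - S y\<close> is \<open>x - y\<close> minus the difference of residuals;
  squaring nonexpansiveness and expanding shows that \<open>I - S\<close> is cocoercive with
  constant \<open>1/2\<close>.\<close>

lemma cocoercive_residual:
  assumes "snorm M (S x - S y) \<le> snorm M (x - y)"
  shows "ip ((x - S x) - (y - S y)) ((x - S x) - (y - S y)) \<le> 2 * ip ((x - S x) - (y - S y)) (x - y)"
proof -
  define d r where "d = x - y" and "r = (x - S x) - (y - S y)"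
  have e: "S x - S y = 1 *\<^sub>R d + (-1) *\<^sub>R r"
    unfolding d_def r_def by simp
  have "(snorm M (S x - S y))\<^sup>2 \<le> (snorm M d)\<^sup>2"
    using assms snorm_nonneg by (intro power_mono) (auto simp: d_def)
  then show ?thesis
    unfolding e snorm_sq ip_square using sym[of d r] by (simp flip: d_def r_def)
qed

text \<open>
  The potential \<open>k(k+1)/2 \<parallel>r\<^sub>k\<parallel>\<^sup>2 + (k+1) \<langle>r\<^sub>k, x\<^sub>k - x\<^sub>0\<rangle>\<close> of the residuals \<open>r\<^sub>k = x\<^sub>k - S x\<^sub>k\<close>
  decreases along the iteration.
\<close>

lemma halpern_potential:
  fixes x :: "nat \<Rightarrow> 'a"
  assumes S: "\<And>x y. snorm M (S x - S y) \<le> snorm M (x - y)"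
    and x: "\<And>k. x (Suc k) = (1 / (real k + 2)) *\<^sub>R x 0 + ((real k + 1) / (real k + 2)) *\<^sub>R S (x k)"
  shows "real k * (real k + 1) / 2 * ip (x k - S (x k)) (x k - S (x k))
    + (real k + 1) * ip (x k - S (x k)) (x k - x 0) \<le> 0"
proof (induction k)
  case 0
  then show ?case by (simp add: linear_0[OF lin])
next
  case (Suc k)
  define K where "K = real k + 1"
  have K: "K > 0" by (simp add: K_def)
  define a b s where "a = x k - S (x k)" and "b = x (Suc k) - S (x (Suc k))"
    and "s = x 0 - x (Suc k)"
  have "(K + 1) *\<^sub>R x (Suc k) = x 0 + K *\<^sub>R S (x k)"
    unfolding x[of k] by (simp add: K_def scaleR_add_right add.commute)
  also have "S (x k) = x k - a" by (simp add: a_def)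
  finally have rec: "(K + 1) *\<^sub>R x (Suc k) = x 0 + K *\<^sub>R (x k - a)" .
  \<comment> \<open>The recursion expresses the increment and the displacement from the anchor
    through \<open>s\<close> and \<open>a\<close>, so that only inner products of \<open>a\<close>,
    \<open>b\<close> and \<open>s\<close> remain.\<close>
  have d: "K *\<^sub>R (x (Suc k) - x k) = s - K *\<^sub>R a"
    using rec by (simp add: s_def algebra_simps)
  have d0: "K *\<^sub>R (x k - x 0) = K *\<^sub>R a - (K + 1) *\<^sub>R s"
    using rec by (simp add: s_def algebra_simps)
  have "ip a (K *\<^sub>R (x k - x 0)) = ip a (K *\<^sub>R a - (K + 1) *\<^sub>R s)"
    by (simp only: d0)
  then have V: "K * ip a (x k - x 0) = K * ip a a - (K + 1) * ip a s"
    by (simp only: ip_simps inner_scaleR_right)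
  have coc: "ip (b - a) (b - a) \<le> 2 * ip (b - a) (x (Suc k) - x k)"
    using cocoercive_residual[where S = S, OF S, of "x (Suc k)" "x k"] by (simp add: a_def b_def)
  have "ip (b - a) (K *\<^sub>R (x (Suc k) - x k)) = ip (b - a) (s - K *\<^sub>R a)"
    by (simp only: d)
  then have "K * ip (b - a) (x (Suc k) - x k) = ip b s - ip a s - K * (ip a b - ip a a)"
    using sym[of a b] by (simp only: ip_simps inner_scaleR_right)
  moreover have "ip (b - a) (b - a) = ip b b - 2 * ip a b + ip a a"
    using sym[of a b] by (simp add: ip_simps)
  moreover have "K * ip (b - a) (b - a) \<le> 2 * (K * ip (b - a) (x (Suc k) - x k))"
    using mult_left_mono[OF coc, of K] K by simp
  ultimately have "K * (ip b b - 2 * ip a b + ip a a) \<le> 2 * (ip b s - ip a s - K * (ip a b - ip a a))"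
    by (simp only:)
  \<comment> \<open>The mixed term \<open>-2 * K * ip a b\<close> stands on both sides and cancels,
    which separates the new residual from the old one.\<close>
  then have key: "K * ip b b - 2 * ip b s \<le> K * ip a a - 2 * ip a s"
    by (simp add: algebra_simps)
  \<comment> \<open>The factor \<open>K + 1\<close> makes the two sides twice the potential at
    \<open>Suc k\<close> and twice the potential at \<open>k\<close>.\<close>
  have "(K + 1) * (K * ip b b - 2 * ip b s) \<le> (K + 1) * (K * ip a a - 2 * ip a s)"
    using key K by (intro mult_left_mono) auto
  also have "\<dots> = 2 * ((K - 1) * K / 2 * ip a a + K * ip a (x k - x 0))"
    unfolding V by (simp add: field_simps)
  also have "\<dots> \<le> 0"
    using Suc.IH by (simp add: K_def a_def)
  finally have "(K + 1) * (K * ip b b - 2 * ip b s) \<le> 0" .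
  moreover have e: "ip b (x (Suc k) - x 0) = - ip b s" by (simp add: s_def ip_simps)
  ultimately show ?case
    unfolding b_def[symmetric] e by (simp add: K_def algebra_simps)
qed

text \<open>Cocoercivity between \<open>x k\<close> and the fixed point \<open>z\<close> bounds
  \<open>ip r (x k - z)\<close> from below. Inserted into the potential bound it replaces
  \<open>x k\<close> by \<open>x 0\<close>; Cauchy-Schwarz and division by \<open>snorm M r\<close>
  then give the rate.\<close>

lemma halpern_rate:
  fixes x :: "nat \<Rightarrow> 'a"
  assumes S: "\<And>x y. snorm M (S x - S y) \<le> snorm M (x - y)"
    and x: "\<And>k. x (Suc k) = (1 / (real k + 2)) *\<^sub>R x 0 + ((real k + 1) / (real k + 2)) *\<^sub>R S (x k)"
    and z: "S z = z"
  shows "snorm M (x k - S (x k)) \<le> 2 / (real k + 1) * snorm M (x 0 - z)"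
proof -
  define r where "r = x k - S (x k)"
  have V: "real k / 2 * ip r r + ip r (x k - x 0) \<le> 0"
  proof -
    have "(real k + 1) * (real k / 2 * ip r r + ip r (x k - x 0)) \<le> 0"
      using halpern_potential[OF S x, of k] by (simp add: r_def algebra_simps)
    then show ?thesis by (simp add: mult_le_0_iff)
  qed
  have "ip r r \<le> 2 * ip r (x k - z)"
    using cocoercive_residual[where S = S, OF S, of "x k" z] by (simp add: z r_def)
  moreover have "ip r (x k - x 0) = ip r (x k - z) - ip r (x 0 - z)"
    by (simp add: ip_simps)
  ultimately have "(real k + 1) / 2 * ip r r \<le> ip r (x 0 - z)"
    using V by (simp add: field_simps)
  also have "\<dots> \<le> snorm M r * snorm M (x 0 - z)" by (rule Cauchy_Schwarz)
  finally have "snorm M r * ((real k + 1) * snorm M r) \<le> snorm M r * (2 * snorm M (x 0 - z))"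
    by (simp flip: snorm_sq add: power2_eq_square field_simps)
  then have "(real k + 1) * snorm M r \<le> 2 * snorm M (x 0 - z)"
    using snorm_nonneg[of r] snorm_nonneg[of "x 0 - z"] by (cases "snorm M r = 0") auto
  then show ?thesis by (simp add: r_def field_simps)
qed

section \<open>Relaxation, distance to a set, and restarts\<close>

text \<open>With \<open>e = d - p\<close> the relaxed difference is \<open>p - \<gamma> e\<close>
  while \<open>d = p + e\<close>. Their squared seminorms differ by exactly
  \<open>1 + \<gamma>\<close> times the expression assumed nonnegative.\<close>

lemma relaxed_le:
  assumes "- 1 \<le> \<gamma>" and "0 \<le> 2 * ip p (d - p) + (1 - \<gamma>) * ip (d - p) (d - p)"
  shows "snorm M ((1 + \<gamma>) *\<^sub>R p - \<gamma> *\<^sub>R d) \<le> snorm M d"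
proof -
  define e where "e = d - p"
  have "(1 + \<gamma>) *\<^sub>R p - \<gamma> *\<^sub>R d = 1 *\<^sub>R p + (- \<gamma>) *\<^sub>R e" "d = 1 *\<^sub>R p + 1 *\<^sub>R e"
    by (simp_all add: e_def algebra_simps)
  moreover have "0 \<le> (1 + \<gamma>) * (2 * ip p e + (1 - \<gamma>) * ip e e)"
    using assms by (intro mult_nonneg_nonneg) (auto simp: e_def)
  then have "ip (1 *\<^sub>R p + (- \<gamma>) *\<^sub>R e) (1 *\<^sub>R p + (- \<gamma>) *\<^sub>R e) \<le> ip (1 *\<^sub>R p + 1 *\<^sub>R e) (1 *\<^sub>R p + 1 *\<^sub>R e)"
    unfolding ip_square by (simp add: power2_eq_square algebra_simps)
  ultimately show ?thesis by (simp add: snorm_def)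
qed

text \<open>Carries a bound valid for every solution over to the infimum, so that no nearest point
  has to be chosen.\<close>

lemma le_mult_sdist:
  assumes "W \<noteq> {}" "0 \<le> c" "\<And>z. z \<in> W \<Longrightarrow> a \<le> c * snorm M (u - z)"
  shows "a \<le> c * sdist M u W"
proof (cases "c = 0")
  case True
  then show ?thesis using assms by auto
next
  case False
  then have "a / c \<le> sdist M u W"
    unfolding sdist_def using assms by (intro cINF_greatest) (auto simp: field_simps)
  then show ?thesis using False assms(2) by (simp add: field_simps)
qed

text \<open>At the end of a cycle the Halpern rate bounds the residual above by the starting
  distance, and sharpness bounds it below by the final distance. The cycle length makes the quotient
  of the constants at most \<open>\<beta>\<close>.\<close>

lemma restarted_halpern:
  fixes w :: "nat \<Rightarrow> nat \<Rightarrow> 'a"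
  assumes S: "\<And>x y. snorm M (relaxed \<gamma> F x - relaxed \<gamma> F y) \<le> snorm M (x - y)"
    and fix_F: "\<And>z. z \<in> W \<Longrightarrow> F z = z" and W: "W \<noteq> {}"
    and \<gamma>: "-1 < \<gamma>" and \<alpha>: "\<alpha> > 0" and \<beta>: "\<beta> > 0"
    and m: "real m \<ge> 2 / (\<alpha> * \<beta> * (1 + \<gamma>))"
    and step: "\<And>n k. w n (Suc k) = (1 / (real k + 2)) *\<^sub>R w n 0
                + ((real k + 1) / (real k + 2)) *\<^sub>R relaxed \<gamma> F (w n k)"
    and restart: "\<And>n. w (Suc n) 0 = w n m"
    and sharp: "\<And>n. \<alpha> * sdist M (w n m) W \<le> snorm M (w n m - F (w n m))"
  shows "sdist M (w n 0) W \<le> \<beta> ^ n * sdist M (w 0 0) W"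
proof (induction n)
  case 0
  then show ?case by simp
next
  case (Suc n)
  let ?u = "w n m"
  have rate: "snorm M (?u - relaxed \<gamma> F ?u) \<le> 2 / (real m + 1) * sdist M (w n 0) W"
  proof (rule le_mult_sdist[OF W])
    fix z assume "z \<in> W"
    then have "relaxed \<gamma> F z = z"
      by (simp add: fix_F relaxed_def algebra_simps)
    then show "snorm M (?u - relaxed \<gamma> F ?u) \<le> 2 / (real m + 1) * snorm M (w n 0 - z)"
      by (intro halpern_rate[OF S, where x="w n"] step)
  qed simp
  have "?u - relaxed \<gamma> F ?u = (1 + \<gamma>) *\<^sub>R (?u - F ?u)"
    by (simp add: relaxed_def algebra_simps)
  then have "(1 + \<gamma>) * snorm M (?u - F ?u) = snorm M (?u - relaxed \<gamma> F ?u)"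
    using \<gamma> by (simp add: snorm_scale)
  moreover have "(1 + \<gamma>) * (\<alpha> * sdist M ?u W) \<le> (1 + \<gamma>) * snorm M (?u - F ?u)"
    using sharp \<gamma> by (intro mult_left_mono) auto
  ultimately have 1: "\<alpha> * (1 + \<gamma>) * sdist M ?u W \<le> 2 / (real m + 1) * sdist M (w n 0) W"
    using rate by (simp add: mult_ac)
  have pos: "0 < \<alpha> * (1 + \<gamma>)" using \<alpha> \<gamma> by simp
  \<comment> \<open>The rate carries \<open>m + 1\<close> in its denominator, while the choice of
    the cycle length bounds \<open>m\<close> itself.\<close>
  have "2 \<le> real m * (\<alpha> * \<beta> * (1 + \<gamma>))"
    using m \<alpha> \<beta> \<gamma> by (subst (asm) pos_divide_le_eq) auto
  also have "\<dots> \<le> (real m + 1) * (\<alpha> * \<beta> * (1 + \<gamma>))"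
    using \<alpha> \<beta> \<gamma> by (intro mult_right_mono) auto
  finally have 2: "2 / (real m + 1) \<le> \<alpha> * (1 + \<gamma>) * \<beta>"
    by (simp add: field_simps)
  have D: "0 \<le> sdist M (w n 0) W"
    unfolding sdist_def by (intro cINF_greatest W snorm_nonneg)
  have "\<alpha> * (1 + \<gamma>) * sdist M ?u W \<le> \<alpha> * (1 + \<gamma>) * (\<beta> * sdist M (w n 0) W)"
    using 1 mult_right_mono[OF 2 D] by (simp add: mult_ac)
  then have "sdist M ?u W \<le> \<beta> * sdist M (w n 0) W"
    using pos by (simp only: mult_le_cancel_left_pos)
  also have "\<dots> \<le> \<beta> * (\<beta> ^ n * sdist M (w 0 0) W)"
    using Suc.IH \<beta> by (intro mult_left_mono) auto
  finally show ?case by (simp add: restart)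
qed

end

section \<open>Convex functions and subdifferentials\<close>

lemma DERIV_along_line:
  assumes "GDERIV k (x + t *\<^sub>R d) :> D"
  shows "((\<lambda>s. k (x + s *\<^sub>R d)) has_field_derivative inner D d) (at t)"
proof -
  have "((\<lambda>s. x + s *\<^sub>R d) has_derivative (\<lambda>s. s *\<^sub>R d)) (at t)"
    by (auto intro!: derivative_eq_intros)
  moreover have "(k has_derivative (\<lambda>e. inner e D)) (at (x + t *\<^sub>R d))"
    using assms by (simp add: gderiv_def)
  ultimately have "((\<lambda>s. k (x + s *\<^sub>R d)) has_derivative (\<lambda>s. inner (s *\<^sub>R d) D)) (at t)"
    by (rule has_derivative_compose)
  then show ?thesis
    by (simp add: has_field_derivative_def inner_commute mult_commute_abs)
qed

text \<open>Restriction to the line through \<open>x\<close> and \<open>z\<close> reduces the claim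
  to the tangent bound for convex functions of one real variable.\<close>

lemma convex_on_above_tangent_GDERIV:
  assumes k: "convex_on UNIV k" and D: "GDERIV k x :> D"
  shows "k x + inner D (z - x) \<le> k z"
proof -
  let ?\<phi> = "\<lambda>t::real. k (x + t *\<^sub>R (z - x))"
  have "convex_on UNIV ?\<phi>"
  proof (rule convex_onI)
    fix t s r :: real assume t: "0 < t" "t < 1"
    have "x + ((1 - t) *\<^sub>R s + t *\<^sub>R r) *\<^sub>R (z - x)
      = (1 - t) *\<^sub>R (x + s *\<^sub>R (z - x)) + t *\<^sub>R (x + r *\<^sub>R (z - x))"
      by (simp add: algebra_simps)
    then show "?\<phi> ((1 - t) *\<^sub>R s + t *\<^sub>R r) \<le> (1 - t) * ?\<phi> s + t * ?\<phi> r"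
      using convex_onD[OF k, of t "x + s *\<^sub>R (z - x)" "x + r *\<^sub>R (z - x)"] t by simp
  qed simp
  moreover have "(?\<phi> has_field_derivative inner D (z - x)) (at 0)"
    using DERIV_along_line[where t=0] D by simp
  ultimately have "inner D (z - x) * (1 - 0) \<le> ?\<phi> 1 - ?\<phi> 0"
    by (intro convex_on_imp_above_tangent[where A=UNIV]) auto
  then show ?thesis by simp
qed

lemma convex_on_gradient_mono:
  assumes "convex_on UNIV k" "\<And>x. GDERIV k x :> G x"
  shows "0 \<le> inner (G x - G y) (x - y)"
  using convex_on_above_tangent_GDERIV[OF assms(1) assms(2)[of x], of y]
    convex_on_above_tangent_GDERIV[OF assms(1) assms(2)[of y], of x]
  by (simp add: inner_diff_left inner_diff_right)

text \<open>Adding the two subgradient inequalities cancels \<open>g x\<close> and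
  \<open>g y\<close>, which \<open>subdiff\<close> forces to be finite.\<close>

lemma subdiff_mono:
  assumes "s \<in> subdiff g x" "t \<in> subdiff g y"
  shows "0 \<le> inner (s - t) (x - y)"
proof -
  obtain a c where g: "g x = ereal a" "g y = ereal c"
    using assms by (auto simp: subdiff_def)
  have "g x + ereal (inner s (y - x)) \<le> g y" "g y + ereal (inner t (x - y)) \<le> g x"
    using assms by (auto simp: subdiff_def)
  then have "a + inner s (y - x) \<le> c" "c + inner t (x - y) \<le> a"
    by (simp_all add: g)
  then show ?thesis by (simp add: inner_diff_left inner_diff_right)
qed

lemma convex_funD:
  assumes "convex_fun g" "g x = ereal a" "g z = ereal c" "0 \<le> t" "t \<le> 1"
  shows "g (x + t *\<^sub>R (z - x)) \<le> ereal (a + t * (c - a))"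
proof -
  have "(1 - t) *\<^sub>R (x, a) + t *\<^sub>R (z, c) \<in> epi g"
    using assms by (intro convexD[of "epi g"]) (auto simp: convex_fun_def epi_def)
  then show ?thesis by (simp add: epi_def algebra_simps)
qed

section \<open>Sum rule for a differentiable and an extended-valued function\<close>

text \<open>The tangent inequality of \<open>k\<close> is added to the subgradient inequality of
  \<open>g\<close>.\<close>

lemma subdiff_add_GDERIV_intro:
  assumes k: "convex_on UNIV k" and D: "GDERIV k x :> D" and g: "proper_fun g"
    and s: "s - D \<in> subdiff g x"
  shows "s \<in> subdiff (\<lambda>z. ereal (k z) + g z) x"
proof -
  obtain a where a: "g x = ereal a" using s by (auto simp: subdiff_def)
  have "ereal (k x) + g x + ereal (inner s (z - x)) \<le> ereal (k z) + g z" for z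
  proof (cases "g z")
    case (real c)
    have "g x + ereal (inner (s - D) (z - x)) \<le> g z"
      using s by (simp add: subdiff_def)
    then show ?thesis
      using convex_on_above_tangent_GDERIV[OF k D, of z] real a by (simp add: inner_diff_left)
  qed (use g a in \<open>auto simp: proper_fun_def\<close>)
  then show ?thesis
    using a by (simp add: subdiff_def)
qed

text \<open>
  Compare difference quotients on the segment from \<open>x\<close> to \<open>z\<close>: convexity makes the quotient of \<open>g\<close>
  at most \<open>g z - g x\<close>, and that of \<open>k\<close> tends to \<open>\<langle>D, z - x\<rangle>\<close>.
\<close>

lemma subdiff_add_GDERIV_dest:
  assumes D: "GDERIV k x :> D" and g: "convex_fun g" "proper_fun g"
    and s: "s \<in> subdiff (\<lambda>z. ereal (k z) + g z) x"
  shows "s - D \<in> subdiff g x"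
proof -
  obtain a where a: "g x = ereal a"
    using s by (cases "g x") (auto simp: subdiff_def)
  have "g x + ereal (inner (s - D) (z - x)) \<le> g z" for z
  proof (cases "g z")
    case (real c)
    let ?\<phi> = "\<lambda>t::real. k (x + t *\<^sub>R (z - x))"
    have "(?\<phi> has_field_derivative inner D (z - x)) (at 0)"
    using DERIV_along_line[where t=0] D by simp
    then have "((\<lambda>t. (?\<phi> t - ?\<phi> 0) / t) \<longlongrightarrow> inner D (z - x)) (at 0)"
      by (simp add: has_field_derivative_iff)
    then have "((\<lambda>t. (?\<phi> t - ?\<phi> 0) / t) \<longlongrightarrow> inner D (z - x)) (at_right 0)"
      by (rule filterlim_mono) (auto simp: at_le)
    moreover have "eventually (\<lambda>t::real. t \<in> {0<..<1}) (at_right 0)"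
      by (rule eventually_at_right_real) simp
    then have "eventually (\<lambda>t. inner s (z - x) - (c - a) \<le> (?\<phi> t - ?\<phi> 0) / t) (at_right 0)"
    proof (rule eventually_mono)
      fix t :: real assume t: "t \<in> {0<..<1}"
      let ?y = "x + t *\<^sub>R (z - x)"
      have gy: "g ?y \<le> ereal (a + t * (c - a))"
        using convex_funD[OF g(1) a real] t by simp
      moreover have "g ?y \<noteq> -\<infinity>" using g(2) by (simp add: proper_fun_def)
      ultimately obtain e where e: "g ?y = ereal e" by (cases "g ?y") auto
      have "ereal (k x) + g x + ereal (inner s (?y - x)) \<le> ereal (k ?y) + g ?y"
        using s unfolding subdiff_def by blast
      then have "k x + a + t * inner s (z - x) \<le> k ?y + e"
        by (simp add: a e)
      also have "e \<le> a + t * (c - a)" using gy e by simp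
      finally have "t * (inner s (z - x) - (c - a)) \<le> ?\<phi> t - ?\<phi> 0"
        by (simp add: algebra_simps)
      then show "inner s (z - x) - (c - a) \<le> (?\<phi> t - ?\<phi> 0) / t"
        using t by (simp add: field_simps)
    qed
    ultimately have "inner s (z - x) - (c - a) \<le> inner D (z - x)"
      by (rule tendsto_lowerbound) simp
    then show ?thesis using real a by (simp add: inner_diff_left)
  qed (use g in \<open>auto simp: proper_fun_def\<close>)
  then show ?thesis using a by (simp add: subdiff_def)
qed

section \<open>Cocoercivity of Lipschitz gradients\<close>

text \<open>Along the segment, \<open>?q\<close> is \<open>h\<close> minus the varying part of its
  quadratic model. Lipschitz continuity and Cauchy-Schwarz make its derivative nonpositive on
  \<open>[0, 1]\<close>.\<close>

lemma descent_lemma: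
  fixes h :: "'a::real_inner \<Rightarrow> real"
  assumes D: "\<And>x. GDERIV h x :> G x" and L: "L-lipschitz_on UNIV G"
  shows "h y \<le> h x + inner (G x) (y - x) + L / 2 * (norm (y - x))\<^sup>2"
proof -
  define d where "d = y - x"
  let ?q = "\<lambda>t. h (x + t *\<^sub>R d) - t * inner (G x) d - L / 2 * t\<^sup>2 * (norm d)\<^sup>2"
  have "?q 1 \<le> ?q 0"
  proof (rule DERIV_nonpos_imp_nonincreasing[where f="?q"])
    fix t :: real assume t: "0 \<le> t" "t \<le> 1"
    have "((\<lambda>t. h (x + t *\<^sub>R d)) has_field_derivative inner (G (x + t *\<^sub>R d)) d) (at t)"
      by (rule DERIV_along_line[OF D])
    then have "(?q has_field_derivative
        inner (G (x + t *\<^sub>R d)) d - inner (G x) d - L * t * (norm d)\<^sup>2) (at t)"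
      by (auto intro!: derivative_eq_intros)
    moreover have "inner (G (x + t *\<^sub>R d)) d - inner (G x) d \<le> L * t * (norm d)\<^sup>2"
    proof -
      have "inner (G (x + t *\<^sub>R d) - G x) d \<le> norm (G (x + t *\<^sub>R d) - G x) * norm d"
        by (rule norm_cauchy_schwarz)
      also have "\<dots> \<le> (L * norm (t *\<^sub>R d)) * norm d"
        using lipschitz_onD[OF L, of "x + t *\<^sub>R d" x] by (intro mult_right_mono) (auto simp: dist_norm)
      finally show ?thesis using t by (simp add: inner_diff_left power2_eq_square mult_ac)
    qed
    ultimately show "\<exists>y. (?q has_field_derivative y) (at t) \<and> y \<le> 0" by fastforce
  qed simp
  then show ?thesis by (simp add: d_def)
qed

text \<open>At an auxiliary point \<open>z\<close>, the tangent at \<open>x\<close> bounds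
  \<open>h\<close> from below and the descent lemma at \<open>y\<close> bounds it from above. The
  resulting sharpened tangent inequality is then symmetrized.\<close>

lemma Baillon_Haddad:
  fixes h :: "'a::real_inner \<Rightarrow> real"
  assumes h: "convex_on UNIV h" and D: "\<And>x. GDERIV h x :> G x" and L: "L-lipschitz_on UNIV G"
  shows "(norm (G x - G y))\<^sup>2 \<le> L * inner (G x - G y) (x - y)"
proof (cases "L = 0")
  case True
  then show ?thesis using lipschitz_onD[OF L, of x y] by simp
next
  case False
  then have Lpos: "L > 0" using lipschitz_on_nonneg[OF L] by simp
  have *: "h x + inner (G x) (y - x) + 1 / (2 * L) * (norm (G y - G x))\<^sup>2 \<le> h y" for x y
  proof -
    define e where "e = G y - G x"
    \<comment> \<open>This gradient step minimizes, over \<open>z\<close>, the gap between the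
      quadratic upper bound at \<open>y\<close> and the tangent at \<open>x\<close>.\<close>
    define z where "z = y - (1 / L) *\<^sub>R e"
    have "h x + inner (G x) (z - x) \<le> h z"
      by (rule convex_on_above_tangent_GDERIV[OF h D])
    also have "\<dots> \<le> h y + inner (G y) (z - y) + L / 2 * (norm (z - y))\<^sup>2"
      by (rule descent_lemma[OF D L])
    finally have "h x + inner (G x) (y - x) \<le> h y + inner e (z - y) + L / 2 * (norm (z - y))\<^sup>2"
      by (simp add: e_def inner_diff_left inner_diff_right)
    moreover have "inner e (z - y) = - (norm e)\<^sup>2 / L" "(norm (z - y))\<^sup>2 = (norm e)\<^sup>2 / L\<^sup>2"
      by (simp_all add: z_def power2_norm_eq_inner power2_eq_square dot_square_norm)
    ultimately show ?thesis
      using Lpos by (simp flip: e_def add: power2_eq_square field_simps)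
  qed
  \<comment> \<open>Adding the inequality to its copy with \<open>x\<close> and \<open>y\<close>
    exchanged cancels the values of \<open>h\<close>.\<close>
  have "1 / L * (norm (G x - G y))\<^sup>2 \<le> inner (G x - G y) (x - y)"
    using *[of x y] *[of y x] Lpos
    by (simp add: inner_diff_left inner_diff_right norm_minus_commute field_simps)
  then show ?thesis using Lpos by (simp add: field_simps)
qed

section \<open>Existence of minimizers\<close>

text \<open>A point strictly below the graph is separated from the closed convex epigraph; the
  hyperplane, solved for its last coordinate, is the minorant.\<close>

lemma affine_minorant:
  fixes g :: "'a::euclidean_space \<Rightarrow> ereal"
  assumes "proper_fun g" "closed_fun g" "convex_fun g"
  obtains p c where "\<And>x t. (x, t) \<in> epi g \<Longrightarrow> inner p x + c \<le> t"
proof -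
  obtain x0 where x0: "g x0 \<noteq> \<infinity>" "g x0 \<noteq> -\<infinity>"
    using assms(1) unfolding proper_fun_def by blast
  then obtain r where r: "g x0 = ereal r" by (cases "g x0") auto
  have "(x0, r - 1) \<notin> epi g" by (simp add: epi_def r)
  then obtain a d where "inner a (x0, r - 1) < d" and a: "\<forall>u\<in>epi g. d < inner a u"
    using separating_hyperplane_closed_point[of "epi g" "(x0, r - 1)"] assms
    by (auto simp: closed_fun_def convex_fun_def)
  obtain q \<tau> where q: "a = (q, \<tau>)" by (cases a)
  have lt: "inner q x0 + \<tau> * (r - 1) < d"
    using \<open>inner a (x0, r - 1) < d\<close> by (simp add: q)
  have gt: "d < inner q x + \<tau> * t" if "(x, t) \<in> epi g" for x t
    using a that by (force simp: q)
  have "(x0, r) \<in> epi g" by (simp add: epi_def r)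
  \<comment> \<open>The points \<open>(x0, r - 1)\<close> and \<open>(x0, r)\<close> lie on opposite
    sides, so the hyperplane is not vertical.\<close>
  from gt[OF this] lt have \<tau>: "0 < \<tau>" by (simp add: algebra_simps)
  show thesis
  proof (rule that)
    fix x t assume "(x, t) \<in> epi g"
    from gt[OF this] \<tau> show "inner (- (1 / \<tau>) *\<^sub>R q) x + d / \<tau> \<le> t"
      by (simp add: field_simps)
  qed
qed

text \<open>Minimizing \<open>k x + t\<close> over the epigraph keeps the objective real and
  continuous. Quadratic growth of \<open>k\<close> against the affine minorant of \<open>g\<close>
  makes a sublevel set compact, and a minimizer has subgradient \<open>0\<close>.\<close>

lemma strongly_convex_min:
  fixes g :: "'a::euclidean_space \<Rightarrow> ereal"
  assumes g: "proper_fun g" "closed_fun g" "convex_fun g"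
    and k: "continuous_on UNIV k"
    and growth: "\<And>x. inner q x + e + \<mu> * (norm x)\<^sup>2 \<le> k x" and \<mu>: "0 < \<mu>"
  obtains x where "0 \<in> subdiff (\<lambda>z. ereal (k z) + g z) x"
proof -
  obtain p c where p: "\<And>x t. (x, t) \<in> epi g \<Longrightarrow> inner p x + c \<le> t"
    using affine_minorant[OF g] by blast
  obtain x0 where x0: "g x0 \<noteq> \<infinity>" "g x0 \<noteq> -\<infinity>"
    using g(1) unfolding proper_fun_def by blast
  then obtain r where r: "g x0 = ereal r" by (cases "g x0") auto
  \<comment> \<open>The level is the value at a point of the effective domain, so the sublevel set
    \<open>S\<close> is nonempty.\<close>
  define C where "C = k x0 + r"
  define S where "S = {u \<in> epi g. k (fst u) + snd u \<le> C}"
  define N where "N = norm p + norm q"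
  \<comment> \<open>For \<open>norm x > 1\<close> the constant in
    \<open>\<mu> * (norm x)^2 \<le> N * norm x + \<bar>C - c - e\<bar>\<close> is absorbed into the
    linear term; dividing by \<open>norm x\<close> gives this radius.\<close>
  define R where "R = max 1 ((N + \<bar>C - c - e\<bar>) / \<mu>)"
  have bound: "norm x \<le> R \<and> \<bar>t\<bar> \<le> \<bar>C\<bar> + \<bar>c\<bar> + \<bar>e\<bar> + N * R" if "(x, t) \<in> S" for x t
  proof -
    have 1: "inner p x + c \<le> t" and 2: "k x + t \<le> C"
      using that p by (auto simp: S_def)
    have px: "\<bar>inner p x\<bar> \<le> norm p * norm x" and qx: "\<bar>inner q x\<bar> \<le> norm q * norm x"
      by (rule Cauchy_Schwarz_ineq2)+
    have "\<mu> * (norm x)\<^sup>2 \<le> N * norm x + (C - c - e)"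
      using growth[of x] 1 2 px qx by (simp add: N_def algebra_simps)
    then have main: "\<mu> * (norm x)\<^sup>2 \<le> N * norm x + \<bar>C - c - e\<bar>" by linarith
    have nx: "norm x \<le> R"
    proof (cases "norm x \<le> 1")
      case False
      then have "\<bar>C - c - e\<bar> * 1 \<le> \<bar>C - c - e\<bar> * norm x"
        by (intro mult_left_mono) auto
      with main have "norm x * (\<mu> * norm x) \<le> norm x * (N + \<bar>C - c - e\<bar>)"
        by (simp add: power2_eq_square algebra_simps)
      moreover have "0 < norm x" using False by linarith
      ultimately have "\<mu> * norm x \<le> N + \<bar>C - c - e\<bar>"
        by (simp only: mult_le_cancel_left_pos)
      then show ?thesis using \<mu> by (simp add: R_def le_max_iff_disj pos_le_divide_eq mult.commute)
    qed (simp add: R_def)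
    have "norm p * norm x \<le> norm p * R" "norm q * norm x \<le> norm q * R"
      using nx by (auto intro: mult_left_mono)
    moreover have "0 \<le> norm p * R" "0 \<le> norm q * R" by (auto simp: R_def)
    moreover have "0 \<le> \<mu> * (norm x)\<^sup>2" using \<mu> by simp
    moreover have "N * R = norm p * R + norm q * R" by (simp add: N_def algebra_simps)
    ultimately have "\<bar>t\<bar> \<le> \<bar>C\<bar> + \<bar>c\<bar> + \<bar>e\<bar> + N * R"
      using growth[of x] 1 2 px qx by linarith
    with nx show ?thesis by simp
  qed
  have cont: "continuous_on UNIV (\<lambda>u. k (fst u) + snd u)"
    by (intro continuous_intros continuous_on_compose2[OF k]) auto
  have "closed {u. k (fst u) + snd u \<le> C}"
    by (rule closed_Collect_le[OF cont continuous_on_const])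
  then have "closed S"
    using g(2) unfolding S_def closed_fun_def Collect_conj_eq Collect_mem_eq by (intro closed_Int)
  moreover have "bounded S"
  proof (rule bounded_subset)
    show "bounded (cball (0::'a) R \<times> cball (0::real) (\<bar>C\<bar> + \<bar>c\<bar> + \<bar>e\<bar> + N * R))"
      by (intro bounded_Times bounded_cball)
    show "S \<subseteq> cball 0 R \<times> cball 0 (\<bar>C\<bar> + \<bar>c\<bar> + \<bar>e\<bar> + N * R)"
      using bound by auto
  qed
  ultimately have "compact S" by (simp add: compact_eq_bounded_closed)
  moreover have "(x0, r) \<in> S" by (simp add: S_def epi_def r C_def)
  ultimately have "\<exists>u\<in>S. \<forall>v\<in>S. k (fst u) + snd u \<le> k (fst v) + snd v"
    by (intro continuous_attains_inf continuous_on_subset[OF cont]) auto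
  then obtain x t where xt: "(x, t) \<in> S"
    and min: "\<And>z s. (z, s) \<in> S \<Longrightarrow> k x + t \<le> k z + s"
    by force
  have "g x \<le> ereal t" using xt by (simp add: S_def epi_def)
  moreover have "g x \<noteq> -\<infinity>" using g(1) by (simp add: proper_fun_def)
  ultimately obtain a where a: "g x = ereal a" "a \<le> t" by (cases "g x") auto
  have "ereal (k x) + g x \<le> ereal (k z) + g z" for z
  proof (cases "g z")
    case (real s)
    have "k x + t \<le> k z + s"
    proof (cases "(z, s) \<in> S")
      \<comment> \<open>A point of the epigraph outside \<open>S\<close> has objective above
        \<open>C\<close>, hence above the minimum.\<close>
      case False
      with real xt show ?thesis by (auto simp: S_def epi_def)
    qed (rule min)
    with real a show ?thesis by simp
  qed (use g(1) in \<open>auto simp: proper_fun_def\<close>)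
  then have "0 \<in> subdiff (\<lambda>z. ereal (k z) + g z) x"
    using a by (simp add: subdiff_def)
  then show thesis by (rule that)
qed

lemma gradient_eq:
  assumes "GDERIV f x :> D" shows "gradient f x = D"
  unfolding gradient_def
proof (rule the_equality)
  show "GDERIV f x :> D" by (rule assms)
  fix E assume "GDERIV f x :> E"
  then have "(\<lambda>h. inner h E) = (\<lambda>h. inner h D)"
    using assms unfolding gderiv_def by (rule has_derivative_unique)
  then show "E = D" by (metis inner_commute vector_eq_rdot)
qed

lemma gradient_const [simp]: "gradient (\<lambda>_. c) x = 0"
  by (rule gradient_eq[OF GDERIV_const])

section \<open>Matrices\<close>

declare transpose_matrix_vector [simp del]

text \<open>The adjoint rule acts on the form \<open>transpose A *v y\<close>, which the simp rule
  removed above would rewrite to \<open>y v* A\<close>.\<close>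

lemma inner_transpose: "inner x (transpose (A :: real ^ 'n ^ 'm) *v y) = inner (A *v x) y"
  by (metis dot_lmul_matrix inner_commute vector_transpose_matrix)

lemma GDERIV_quadratic:
  fixes P :: "real ^ 'n ^ 'n"
  assumes "transpose P = P"
  shows "GDERIV (\<lambda>x. inner x (P *v x) / 2) x :> P *v x"
proof -
  have "((\<lambda>x. inner x (P *v x) / 2) has_derivative (\<lambda>h. (inner x (P *v h) + inner h (P *v x)) / 2)) (at x)"
    by (auto intro!: derivative_eq_intros has_derivative_inner bounded_linear_imp_has_derivative
        matrix_vector_mul_bounded_linear)
  moreover have "inner x (P *v h) = inner h (P *v x)" for h
    using inner_transpose[of h P x] assms by (metis inner_commute)
  ultimately show ?thesis by (simp add: gderiv_def)
qed

lemma GDERIV_least_squares: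
  fixes A :: "real ^ 'n ^ 'm"
  shows "GDERIV (\<lambda>x. \<sigma> / 2 * (norm (A *v x - b))\<^sup>2) x :> \<sigma> *\<^sub>R (transpose A *v (A *v x - b))"
proof -
  have A: "((\<lambda>x. A *v x - b) has_derivative (\<lambda>h. A *v h)) (at x)"
    by (auto intro!: derivative_eq_intros bounded_linear_imp_has_derivative
        matrix_vector_mul_bounded_linear)
  have "((\<lambda>x. \<sigma> / 2 * inner (A *v x - b) (A *v x - b)) has_derivative
      (\<lambda>h. \<sigma> / 2 * (inner (A *v x - b) (A *v h) + inner (A *v h) (A *v x - b)))) (at x)"
    by (intro has_derivative_mult_right has_derivative_inner A)
  then show ?thesis
    by (simp add: gderiv_def power2_norm_eq_inner inner_transpose inner_commute)
qed

section \<open>Smallest eigenvalue and positivity of the block operator\<close>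

text \<open>The minimum \<open>l\<close> of the quadratic form on the unit sphere is an eigenvalue,
  and no eigenvalue is smaller; this also shows that the \<open>LEAST\<close> in
  \<open>lambda_min\<close> exists.\<close>

lemma lambda_min_le_Rayleigh:
  fixes B :: "real ^ 'n ^ 'n"
  assumes B: "transpose B = B"
  shows "lambda_min B * (norm x)\<^sup>2 \<le> inner x (B *v x)"
proof -
  have cont: "continuous_on S (\<lambda>x. inner x (B *v x))" for S :: "(real ^ 'n) set"
    by (intro continuous_intros linear_continuous_on matrix_vector_mul_bounded_linear)
  have "sphere (0 :: real ^ 'n) 1 \<noteq> {}" by simp
  then obtain v where v: "norm v = 1" and min: "\<And>x. norm x = 1 \<Longrightarrow> inner v (B *v v) \<le> inner x (B *v x)"
    using continuous_attains_inf[OF compact_sphere _ cont, of 0 1] by auto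
  define l where "l = inner v (B *v v)"
  have Rayleigh: "l * (norm x)\<^sup>2 \<le> inner x (B *v x)" for x
  proof (cases "x = 0")
    case False
    then have "l \<le> inner (x /\<^sub>R norm x) (B *v (x /\<^sub>R norm x))"
      unfolding l_def by (intro min) simp
    then show ?thesis using False
      by (simp add: matrix_vector_mult_scaleR power2_eq_square field_simps)
  qed simp
  interpret semi_inner "\<lambda>x. B *v x - l *\<^sub>R x"
  proof (rule semi_inner.intro)
    show "linear (\<lambda>x. B *v x - l *\<^sub>R x)"
      by (intro linear_compose_sub matrix_vector_mul_linear linear_compose_scale_right linear_id[unfolded id_def])
    show "inner u (B *v w - l *\<^sub>R w) = inner w (B *v u - l *\<^sub>R u)" for u w
      using inner_transpose[of u B w] by (simp add: B inner_diff_right inner_commute)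
    show "0 \<le> inner u (B *v u - l *\<^sub>R u)" for u
      using Rayleigh[of u] by (simp add: inner_diff_right power2_norm_eq_inner)
  qed
  have "inner v (B *v v - l *\<^sub>R v) = 0"
    using v by (simp add: inner_diff_right l_def norm_eq_1)
  \<comment> \<open>The form of \<open>B - l I\<close> is positive semidefinite and vanishes at
    \<open>v\<close>, so Cauchy-Schwarz against \<open>v\<close> makes the vector
    \<open>B *v v - l *\<^sub>R v\<close> zero.\<close>
  then have "(inner (B *v v - l *\<^sub>R v) (B *v v - l *\<^sub>R v))\<^sup>2 \<le> 0"
    using Cauchy_Schwarz_sq[of "B *v v - l *\<^sub>R v" v] by simp
  then have "B *v v = l *\<^sub>R v" by simp
  moreover have "v \<noteq> 0" using v by auto
  moreover have "l \<le> m" if "u \<noteq> 0" "B *v u = m *\<^sub>R u" for m u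
    using Rayleigh[of u] that by (simp add: power2_norm_eq_inner)
  ultimately have "lambda_min B = l"
    unfolding lambda_min_def by (intro Least_equality) auto
  then show ?thesis using Rayleigh by simp
qed

lemma pos_def_invertible:
  assumes "pos_def Q" shows "invertible Q"
proof -
  have "inj ((*v) Q)"
  proof (rule linear_injective_0[THEN iffD2], simp, intro allI impI)
    fix x assume "Q *v x = 0"
    then have "inner x (Q *v x) = 0" by simp
    then show "x = 0" using assms unfolding pos_def_def by (metis less_irrefl)
  qed
  then show ?thesis
    by (simp add: invertible_left_inverse matrix_left_invertible_injective)
qed

lemma inner_block_op:
  "inner (x, y) (block_op P Q A (x', y'))
    = inner x (P *v x') + inner (A *v x) y' + inner y (A *v x') + inner y (Q *v y')"
  by (simp add: block_op_def inner_add_right inner_transpose)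

lemma semi_inner_block_op:
  assumes "transpose P = P" "transpose Q = Q" "\<And>w. 0 \<le> inner w (block_op P Q A w)"
  shows "semi_inner (block_op P Q A)"
proof (rule semi_inner.intro)
  show "linear (block_op P Q A)"
    by (rule linearI) (auto simp: block_op_def matrix_vector_right_distrib matrix_vector_mult_scaleR
        scaleR_add_right)
  show "inner u (block_op P Q A v) = inner v (block_op P Q A u)" for u v
    using inner_transpose[of "fst u" P "fst v"] inner_transpose[of "snd u" Q "snd v"]
    by (cases u; cases v) (simp add: inner_block_op assms(1,2) inner_commute)
qed (rule assms)

text \<open>Complete the square in \<open>y\<close>, using \<open>Q z = A x\<close> for \<open>z = Q\<^sup>-\<^sup>1 A x\<close>.\<close>

lemma schur_compl_le_block_op:
  assumes Q: "pos_def Q"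
  shows "inner x (schur_compl P Q A *v x) \<le> inner (x, y) (block_op P Q A (x, y))"
proof -
  define z where "z = matrix_inv Q *v (A *v x)"
  have "Q ** matrix_inv Q = mat 1"
    using someI_ex[OF pos_def_invertible[OF Q, unfolded invertible_def]]
    by (simp add: matrix_inv_def)
  then have Qz: "Q *v z = A *v x"
    unfolding z_def by (metis matrix_vector_mul_assoc matrix_vector_mul_lid)
  have psd: "0 \<le> inner v (Q *v v)" for v
    using Q unfolding pos_def_def by (cases "v = 0") (auto intro: less_imp_le)
  have "inner x (schur_compl P Q A *v x) = inner x (P *v x) - inner (A *v x) z"
    by (simp add: schur_compl_def z_def matrix_vector_mult_diff_rdistrib inner_diff_right inner_transpose
        flip: matrix_vector_mul_assoc)
  moreover have "inner z (Q *v y) = inner y (A *v x)"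
    using inner_transpose[of z Q y] Q by (simp add: pos_def_def Qz inner_commute)
  then have "0 \<le> inner y (Q *v y) + 2 * inner y (A *v x) + inner (A *v x) z"
    using psd[of "y + z"] by (simp add: matrix_vector_right_distrib Qz inner_add_left inner_add_right inner_commute)
  ultimately show ?thesis
    by (simp add: inner_block_op inner_commute)
qed

section \<open>The resolvents\<close>

text \<open>The gradient of \<open>f - h + \<sigma>/2 * (norm (A x - b))^2\<close>, the smooth part
  of the backward step in \<open>x\<close>.\<close>

definition smooth_grad ::
  "(real ^ 'n \<Rightarrow> real) \<Rightarrow> real ^ 'n ^ 'm \<Rightarrow> real ^ 'm \<Rightarrow> real \<Rightarrow> (real ^ 'n \<Rightarrow> real) \<Rightarrow> real ^ 'n \<Rightarrow> real ^ 'n"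
  where "smooth_grad f A b \<sigma> h x = gradient f x - gradient h x + \<sigma> *\<^sub>R (transpose A *v (A *v x - b))"

text \<open>\<open>M\<close> contributes \<open>transpose A *v y\<close> and the KKT operator its
  negative, so \<open>y\<close> leaves the first row. In the second row \<open>A *v x\<close> comes
  from both, hence the factor 2.\<close>

lemma mem_linearized_resolvent:
  "(x, y) \<in> sum_inverse (block_op P Q A) (backward_op f g A b \<sigma> h)
      (block_op P Q A (x0, y0) - forward_op h (x0, y0))
    \<longleftrightarrow> P *v x0 + transpose A *v y0 - gradient h x0 - smooth_grad f A b \<sigma> h x - P *v x \<in> subdiff g x
      \<and> Q *v y = A *v x0 + Q *v y0 + b - 2 *\<^sub>R (A *v x)" (is "?mem \<longleftrightarrow> ?v \<in> _ \<and> ?y")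
proof -
  have "?mem \<longleftrightarrow> (\<exists>v\<in>subdiff g x. block_op P Q A (x0, y0) - forward_op h (x0, y0) = block_op P Q A (x, y) +
      ((gradient f x + v - transpose A *v y + \<sigma> *\<^sub>R (transpose A *v (A *v x - b)), A *v x - b) - forward_op h (x, y)))"
    unfolding sum_inverse_def backward_op_def kkt_op_def by blast
  also have "\<dots> \<longleftrightarrow> (\<exists>v\<in>subdiff g x. v = ?v \<and> ?y)"
  proof (intro bex_cong refl)
    fix v
    have "P *v x0 + transpose A *v y0 - gradient h x0 = P *v x + transpose A *v y +
          (gradient f x + v - transpose A *v y + \<sigma> *\<^sub>R (transpose A *v (A *v x - b)) - gradient h x)
        \<longleftrightarrow> v = ?v"
      unfolding smooth_grad_def by (auto simp: algebra_simps)
    moreover have "A *v x0 + Q *v y0 = A *v x + Q *v y + (A *v x - b) \<longleftrightarrow> ?y"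
      by (auto simp: scaleR_2 algebra_simps)
    ultimately show "block_op P Q A (x0, y0) - forward_op h (x0, y0) = block_op P Q A (x, y) +
        ((gradient f x + v - transpose A *v y + \<sigma> *\<^sub>R (transpose A *v (A *v x - b)), A *v x - b) - forward_op h (x, y))
      \<longleftrightarrow> v = ?v \<and> ?y"
      by (simp add: block_op_def forward_op_def)
  qed
  finally show ?thesis by blast
qed

text \<open>Justifies \<open>the_elem\<close>: the inclusion determines \<open>x\<close>, and
  inverting \<open>Q\<close> then determines \<open>y\<close>.\<close>

lemma linearized_map_in_resolvent:
  fixes Q :: "real ^ 'm ^ 'm"
  assumes Q: "invertible Q"
    and solv: "\<And>r. \<exists>!x. r - smooth_grad f A b \<sigma> h x - P *v x \<in> subdiff g x"
  shows "sum_inverse (block_op P Q A) (backward_op f g A b \<sigma> h) (block_op P Q A w - forward_op h w)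
    = {linearized_map f g A b \<sigma> P Q h w}" (is "?S = _")
proof -
  obtain x0 y0 where w: "w = (x0, y0)" by (cases w)
  obtain x where x: "P *v x0 + transpose A *v y0 - gradient h x0 - smooth_grad f A b \<sigma> h x - P *v x \<in> subdiff g x"
    and ux: "\<And>z. P *v x0 + transpose A *v y0 - gradient h x0 - smooth_grad f A b \<sigma> h z - P *v z \<in> subdiff g z \<Longrightarrow> z = x"
    using solv[of "P *v x0 + transpose A *v y0 - gradient h x0"] by blast
  obtain Q' where Q': "Q ** Q' = mat 1" "Q' ** Q = mat 1"
    using Q by (auto simp: invertible_def)
  have Qeq: "Q *v y = q \<longleftrightarrow> y = Q' *v q" for y q
    by (metis Q' matrix_vector_mul_assoc matrix_vector_mul_lid)
  have "(z, y) \<in> ?S \<longleftrightarrow> z = x \<and> y = Q' *v (A *v x0 + Q *v y0 + b - 2 *\<^sub>R (A *v z))" for z y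
    unfolding w mem_linearized_resolvent Qeq using x ux by blast
  then have "?S = {(x, Q' *v (A *v x0 + Q *v y0 + b - 2 *\<^sub>R (A *v x)))}"
    by (intro set_eqI) (metis (lifting) prod.exhaust prod.inject singleton_iff)
  then show ?thesis
    by (simp add: linearized_map_def)
qed

text \<open>Subtracting the forward term from \<open>0 \<in> T z\<close> places \<open>z\<close> in
  its own resolvent set, which is a singleton.\<close>

lemma kkt_set_fixed:
  assumes "invertible Q"
    and "\<And>r. \<exists>!x. r - smooth_grad f A b \<sigma> h x - P *v x \<in> subdiff g x"
    and "z \<in> kkt_set f g A b \<sigma>"
  shows "linearized_map f g A b \<sigma> P Q h z = z"
proof -
  have "0 - forward_op h z \<in> backward_op f g A b \<sigma> h z"
    using assms(3) unfolding backward_op_def kkt_set_def by blast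
  then have "z \<in> sum_inverse (block_op P Q A) (backward_op f g A b \<sigma> h) (block_op P Q A z - forward_op h z)"
    by (force simp: sum_inverse_def)
  then show ?thesis
    unfolding linearized_map_in_resolvent[OF assms(1,2)] by simp
qed

text \<open>Monotonicity of the backward operator along two resolvent steps: an inequality from the
  \<open>x\<close> rows, an identity from the \<open>y\<close> rows.\<close>

lemma resolvent_ineq:
  fixes w1 w2 :: "(real ^ 'n) \<times> (real ^ 'm)"
  assumes "u1 \<in> sum_inverse (block_op P Q A) (backward_op f g A b \<sigma> h) (block_op P Q A w1 - forward_op h w1)"
    and "u2 \<in> sum_inverse (block_op P Q A) (backward_op f g A b \<sigma> h) (block_op P Q A w2 - forward_op h w2)"
    and mono: "\<And>x y. 0 \<le> inner (smooth_grad f A b \<sigma> h x - smooth_grad f A b \<sigma> h y) (x - y)"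
  shows "inner (fst (u1 - u2)) (gradient h (fst w1) - gradient h (fst w2))
    \<le> inner (u1 - u2) (block_op P Q A ((w1 - w2) - (u1 - u2)))"
proof -
  obtain x1 y1 x2 y2 where u: "u1 = (x1, y1)" "u2 = (x2, y2)" by (cases u1; cases u2)
  obtain a1 c1 a2 c2 where w: "w1 = (a1, c1)" "w2 = (a2, c2)" by (cases w1; cases w2)
  define G where "G = smooth_grad f A b \<sigma> h"
  define X Y a c where defs: "X = x1 - x2" "Y = y1 - y2" "a = a1 - a2" "c = c1 - c2"
  define D where "D = gradient h a1 - gradient h a2"
  define s where "s = (\<lambda>a c x. P *v a + transpose A *v c - gradient h a - G x - P *v x)"
  have s: "s a1 c1 x1 \<in> subdiff g x1" "s a2 c2 x2 \<in> subdiff g x2"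
    and q: "Q *v y1 = A *v a1 + Q *v c1 + b - 2 *\<^sub>R (A *v x1)" "Q *v y2 = A *v a2 + Q *v c2 + b - 2 *\<^sub>R (A *v x2)"
    using assms(1,2) by (simp_all add: u w mem_linearized_resolvent s_def G_def)
  have "s a1 c1 x1 - s a2 c2 x2 = (P *v (a - X) + transpose A *v c - D) - (G x1 - G x2)"
    by (simp add: s_def defs D_def matrix_vector_mult_diff_distrib)
  with subdiff_mono[OF s] mono[of x1 x2]
  have "0 \<le> inner (P *v (a - X) + transpose A *v c - D) X"
    by (simp add: inner_diff_left G_def defs)
  then have "0 \<le> inner X (P *v (a - X)) + inner X (transpose A *v c) - inner X D"
    unfolding inner_commute[of _ X] by (simp only: inner_diff_right inner_add_right)
  then have 1: "inner X D \<le> inner X (P *v (a - X)) + inner (A *v X) c"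
    by (simp add: inner_transpose)
  \<comment> \<open>The difference of the \<open>y\<close> equations reduces the second row of the
    block form to \<open>inner (A *v X) Y\<close>, which cancels the \<open>Y\<close> part of the
    coupling term in the first row.\<close>
  have "Q *v (c - Y) = A *v X - A *v (a - X)"
    using q by (simp add: defs matrix_vector_mult_diff_distrib scaleR_2 algebra_simps)
  then have "inner Y (A *v (a - X)) + inner Y (Q *v (c - Y)) = inner (A *v X) Y"
    by (simp add: inner_diff_right inner_commute)
  then have "inner (X, Y) (block_op P Q A (a - X, c - Y)) = inner X (P *v (a - X)) + inner (A *v X) c"
    unfolding inner_block_op by (simp add: inner_diff_right)
  then show ?thesis
    using 1 by (simp add: u w defs D_def)
qed

text \<open>
  Baillon-Haddad turns the forward step into \<open>\<langle>\<delta>, d\<rangle> \<ge> \<parallel>\<delta>\<parallel>\<^sup>2/L\<close>; completing the square against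
  \<open>\<langle>\<delta>, d - p\<rangle>\<close> loses only \<open>L/4 \<parallel>d - p\<parallel>\<^sup>2\<close> in the first component.
\<close>

lemma relaxed_linearized_nonexpansive:
  fixes Q :: "real ^ 'm ^ 'm"
  assumes sym: "transpose P = P" "transpose Q = Q" and Q: "invertible Q"
    and solv: "\<And>r. \<exists>!x. r - smooth_grad f A b \<sigma> h x - P *v x \<in> subdiff g x"
    and mono: "\<And>x y. 0 \<le> inner (smooth_grad f A b \<sigma> h x - smooth_grad f A b \<sigma> h y) (x - y)"
    and h: "convex_lipschitz_gradient L h"
    and psd: "\<And>u. 0 \<le> inner u (block_op P Q A u)"
    and \<gamma>: "-1 \<le> \<gamma>"
    and bound: "\<And>u. L / 2 * (norm (fst u))\<^sup>2 \<le> (1 - \<gamma>) * inner u (block_op P Q A u)"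
  shows "snorm (block_op P Q A) (relaxed \<gamma> (linearized_map f g A b \<sigma> P Q h) u - relaxed \<gamma> (linearized_map f g A b \<sigma> P Q h) w)
    \<le> snorm (block_op P Q A) (u - w)"
proof -
  interpret semi_inner "block_op P Q A"
    using sym psd by (rule semi_inner_block_op)
  let ?F = "linearized_map f g A b \<sigma> P Q h"
  define d p where "d = u - w" and "p = ?F u - ?F w"
  define \<delta> where "\<delta> = gradient h (fst u) - gradient h (fst w)"
  have L: "0 \<le> L" and BH: "(norm \<delta>)\<^sup>2 \<le> L * inner \<delta> (fst d)"
    using h Baillon_Haddad[of h "gradient h" L "fst u" "fst w"]
    by (auto simp: convex_lipschitz_gradient_def \<delta>_def d_def lipschitz_on_nonneg)
  have "?F v \<in> sum_inverse (block_op P Q A) (backward_op f g A b \<sigma> h) (block_op P Q A v - forward_op h v)" for v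
    unfolding linearized_map_in_resolvent[OF Q solv] by (rule singletonI)
  from resolvent_ineq[OF this this mono]
  have ineq: "inner (fst p) \<delta> \<le> ip p (d - p)"
    unfolding p_def d_def \<delta>_def .
  define e where "e = fst (d - p)"
  have "0 \<le> 2 * inner (fst p) \<delta> + L / 2 * (norm e)\<^sup>2"
  proof (cases "L = 0")
    case True
    then show ?thesis using BH by simp
  next
    case False
    have "0 \<le> 2 * (norm (\<delta> - (L / 2) *\<^sub>R e))\<^sup>2" by simp
    also have "\<dots> = 2 * (norm \<delta>)\<^sup>2 - 2 * L * inner \<delta> e + L * L / 2 * (norm e)\<^sup>2"
      by (simp add: power2_norm_eq_inner inner_diff_left inner_diff_right inner_commute field_simps)
    also have "\<dots> \<le> 2 * (L * inner \<delta> (fst d)) - 2 * L * inner \<delta> e + L * L / 2 * (norm e)\<^sup>2"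
      using BH by simp
    \<comment> \<open>As \<open>e = fst d - fst p\<close>, the two products with
      \<open>\<delta>\<close> collapse to the one with \<open>fst p\<close>, and \<open>L\<close>
      factors out.\<close>
    also have "\<dots> = L * (2 * inner (fst p) \<delta> + L / 2 * (norm e)\<^sup>2)"
      by (simp add: e_def inner_diff_right inner_commute algebra_simps)
    finally show ?thesis using L False by (simp add: zero_le_mult_iff)
  qed
  then have "0 \<le> 2 * ip p (d - p) + (1 - \<gamma>) * ip (d - p) (d - p)"
    using ineq bound[of "d - p"] unfolding e_def by linarith
  from relaxed_le[OF \<gamma> this] show ?thesis
    by (simp add: relaxed_def p_def d_def algebra_simps)
qed

lemma forward_op_const: "forward_op (\<lambda>_. c) w = 0"
  by (simp add: forward_op_def zero_prod_def split: prod.split)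

lemma exact_map_eq: "exact_map f g A b \<sigma> P Q = linearized_map f g A b \<sigma> P Q (\<lambda>_. 0)"
  by (intro ext) (simp add: exact_map_def linearized_map_def backward_op_def[abs_def] forward_op_const)

section \<open>Solvability and monotonicity for the two maps\<close>

text \<open>The inverse is assumed for the subdifferential of \<open>f + g\<close>, while the
  resolvent uses the gradient of \<open>f\<close> plus that of \<open>g\<close>; both directions of
  the sum rule identify them.\<close>

lemma exact_solvable:
  assumes f: "convex_lipschitz_gradient L f" and g: "proper_fun g" "convex_fun g"
    and ex: "exact_assms f g A \<sigma> P Q"
  shows "\<exists>!x. r - smooth_grad f A b \<sigma> (\<lambda>_. 0) x - P *v x \<in> subdiff g x"
proof -
  have fc: "convex_on UNIV f" and fD: "GDERIV f x :> gradient f x" for x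
    using f by (auto simp: convex_lipschitz_gradient_def)
  let ?\<Phi> = "\<lambda>z. ereal (f z) + g z"
  obtain R where R: "\<And>v. {x. \<exists>s\<in>subdiff ?\<Phi> x. v = s + P *v x + \<sigma> *\<^sub>R (transpose A *v (A *v x))} = {R v}"
    using ex unfolding exact_assms_def by blast
  \<comment> \<open>The shift absorbs the constant \<open>b\<close> contained in
    \<open>smooth_grad\<close>.\<close>
  define v where "v = r + \<sigma> *\<^sub>R (transpose A *v b)"
  have "r - smooth_grad f A b \<sigma> (\<lambda>_. 0) x - P *v x \<in> subdiff g x
      \<longleftrightarrow> (\<exists>s\<in>subdiff ?\<Phi> x. v = s + P *v x + \<sigma> *\<^sub>R (transpose A *v (A *v x)))" for x
  proof -
    define s where "s = v - P *v x - \<sigma> *\<^sub>R (transpose A *v (A *v x))"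
    have "r - smooth_grad f A b \<sigma> (\<lambda>_. 0) x - P *v x = s - gradient f x"
      by (simp add: smooth_grad_def s_def v_def
          matrix_vector_mult_diff_distrib scaleR_diff_right)
    moreover have "s - gradient f x \<in> subdiff g x \<longleftrightarrow> s \<in> subdiff ?\<Phi> x"
      using subdiff_add_GDERIV_intro[OF fc fD g(1)] subdiff_add_GDERIV_dest[OF fD g(2,1)] by blast
    moreover have "v = t + P *v x + \<sigma> *\<^sub>R (transpose A *v (A *v x)) \<longleftrightarrow> t = s" for t
      by (auto simp: s_def)
    ultimately show ?thesis by auto
  qed
  then have "{x. r - smooth_grad f A b \<sigma> (\<lambda>_. 0) x - P *v x \<in> subdiff g x} = {R v}"
    using R[of v] by simp
  then show ?thesis by (metis (mono_tags, lifting) mem_Collect_eq singletonD singletonI)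
qed

lemma exact_mono:
  assumes f: "convex_lipschitz_gradient L f" and \<sigma>: "0 \<le> \<sigma>"
  shows "0 \<le> inner (smooth_grad f A b \<sigma> (\<lambda>_. 0) x - smooth_grad f A b \<sigma> (\<lambda>_. 0) y) (x - y)"
proof -
  have "smooth_grad f A b \<sigma> (\<lambda>_. 0) x - smooth_grad f A b \<sigma> (\<lambda>_. 0) y
    = (gradient f x - gradient f y) + \<sigma> *\<^sub>R (transpose A *v (A *v (x - y)))"
    by (simp add: smooth_grad_def matrix_vector_mult_diff_distrib scaleR_diff_right)
  moreover have "0 \<le> inner (gradient f x - gradient f y) (x - y)"
    using f by (intro convex_on_gradient_mono[where k = f]) (auto simp: convex_lipschitz_gradient_def)
  moreover have "0 \<le> inner (\<sigma> *\<^sub>R (transpose A *v (A *v (x - y)))) (x - y)"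
    using \<sigma> by (simp add: inner_commute[of _ "x - y"] inner_transpose)
  ultimately show ?thesis by (simp add: inner_add_left)
qed

lemma linearized_GDERIV:
  assumes "convex_lipschitz_gradient L f" "convex_lipschitz_gradient L' h"
  shows "GDERIV (\<lambda>x. f x - h x + \<sigma> / 2 * (norm (A *v x - b))\<^sup>2) x :> smooth_grad f A b \<sigma> h x"
  unfolding smooth_grad_def using assms
  by (intro GDERIV_add GDERIV_diff GDERIV_least_squares) (auto simp: convex_lipschitz_gradient_def)

text \<open>The inclusion is the optimality condition for \<open>k + g\<close> plus a quadratic,
  which has a minimizer. Uniqueness follows since \<open>P\<close> is strongly monotone and the
  other terms are monotone.\<close>

lemma strongly_monotone_solvable:
  fixes P :: "real ^ 'n ^ 'n"
  assumes k: "convex_on UNIV k" "\<And>x. GDERIV k x :> G x"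
    and P: "transpose P = P" "\<And>x. \<mu> * (norm x)\<^sup>2 \<le> inner x (P *v x)" and \<mu>: "0 < \<mu>"
    and g: "proper_fun g" "closed_fun g" "convex_fun g"
  shows "\<exists>!x. r - G x - P *v x \<in> subdiff g x"
proof -
  let ?\<phi> = "\<lambda>x. k x + (inner x (P *v x) / 2 - inner x r)"
  have "GDERIV (\<lambda>x. inner x r) x :> r" for x
    by (auto simp: gderiv_def intro!: derivative_eq_intros)
  then have D: "GDERIV ?\<phi> x :> G x + (P *v x - r)" for x
    by (intro GDERIV_add GDERIV_diff k GDERIV_quadratic P)
  have cont: "continuous_on UNIV ?\<phi>"
    using D has_derivative_continuous unfolding gderiv_def continuous_on_eq_continuous_at[OF open_UNIV] by blast
  \<comment> \<open>The tangent of \<open>k\<close> at \<open>0\<close> supplies the affine part and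
    half the bound on \<open>P\<close> the quadratic part.\<close>
  have growth: "inner (G 0 - r) x + k 0 + \<mu> / 2 * (norm x)\<^sup>2 \<le> ?\<phi> x" for x
    using convex_on_above_tangent_GDERIV[OF k, of 0 x] P(2)[of x]
    by (simp add: inner_diff_left inner_diff_right inner_commute)
  obtain x where "0 \<in> subdiff (\<lambda>z. ereal (?\<phi> z) + g z) x"
    using strongly_convex_min[OF g cont growth] \<mu> by auto
  from subdiff_add_GDERIV_dest[OF D g(3,1) this]
  have x: "r - G x - P *v x \<in> subdiff g x" by (simp add: algebra_simps)
  show ?thesis
  proof (rule ex1I[of _ x])
    fix y assume y: "r - G y - P *v y \<in> subdiff g y"
    have "(r - G x - P *v x) - (r - G y - P *v y) = - (G x - G y) - P *v (x - y)"
      by (simp add: matrix_vector_mult_diff_distrib)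
    with subdiff_mono[OF x y]
    have "0 \<le> - inner (G x - G y) (x - y) - inner (P *v (x - y)) (x - y)"
      by (simp only: inner_diff_left[of "- (G x - G y)"] inner_minus_left)
    with convex_on_gradient_mono[OF k, of x y]
    have "inner (x - y) (P *v (x - y)) \<le> 0"
      by (simp only: inner_commute[of "x - y"])
    with P(2)[of "x - y"] \<mu> have "(norm (x - y))\<^sup>2 \<le> 0"
      by (smt (verit) mult_pos_pos)
    then show "y = x" by simp
  qed (rule x)
qed

theorem theorem6:
  fixes A :: "real ^ 'n ^ 'm" and b :: "real ^ 'm" and \<sigma> :: real
    and f h :: "real ^ 'n \<Rightarrow> real" and g :: "real ^ 'n \<Rightarrow> ereal"
    and P :: "real ^ 'n ^ 'n" and Q :: "real ^ 'm ^ 'm"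
    and L\<^sub>h \<gamma> \<alpha> \<beta> :: real
    and F :: "(real ^ 'n) \<times> (real ^ 'm) \<Rightarrow> (real ^ 'n) \<times> (real ^ 'm)"
    and K :: "((real ^ 'n) \<times> (real ^ 'm)) set"
    and w :: "nat \<Rightarrow> nat \<Rightarrow> (real ^ 'n) \<times> (real ^ 'm)"
    and kstar :: nat
  defines "M \<equiv> block_op P Q A"
    and "W \<equiv> kkt_set f g A b \<sigma>"
  assumes "\<sigma> \<ge> 0"
    and "\<exists>L. convex_lipschitz_gradient L f"
    and "proper_fun g" and "closed_fun g" and "convex_fun g"
    and "pos_semidef P" and "pos_semidef Q"
    and "W \<noteq> {}"
    and "(exact_assms f g A \<sigma> P Q \<and> F = exact_map f g A b \<sigma> P Q \<and> -1 < \<gamma> \<and> \<gamma> \<le> 1) \<or>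
         (linearized_assms f A b \<sigma> P Q h L\<^sub>h \<and> F = linearized_map f g A b \<sigma> P Q h \<and>
            -1 < \<gamma> \<and> \<gamma> < 1 - L\<^sub>h / (2 * lambda_min (schur_compl P Q A)))"
    and "\<alpha> > 0" and "0 < \<beta>" and "\<beta> < 1"
    and "kstar = nat \<lceil>2 / (\<alpha> * \<beta> * (1 + \<gamma>))\<rceil>"
    and "\<And>n k. w n (Suc k) = (1 / (real k + 2)) *\<^sub>R w n 0
                + ((real k + 1) / (real k + 2)) *\<^sub>R relaxed \<gamma> F (w n k)"
    and "\<And>n. w (Suc n) 0 = w n kstar"
    and "\<And>n k. k \<le> kstar \<Longrightarrow> w n k \<in> K"
    and "\<forall>u\<in>K. \<alpha> * sdist M u W \<le> snorm M (u - F u)"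
  shows "\<forall>n. sdist M (w n 0) W \<le> \<beta> ^ n * sdist M (w 0 0) W"
proof -
  obtain L where f: "convex_lipschitz_gradient L f" using assms by blast
  note g = \<open>proper_fun g\<close> \<open>closed_fun g\<close> \<open>convex_fun g\<close>
  have sym: "transpose P = P" "transpose Q = Q"
    using \<open>pos_semidef P\<close> \<open>pos_semidef Q\<close> by (auto simp: pos_semidef_def)
  \<comment> \<open>Both cases are reduced to the same facts, after which the restart argument is
    common.\<close>
  have "-1 < \<gamma> \<and> (\<forall>u. 0 \<le> inner u (M u))
    \<and> (\<forall>u v. snorm M (relaxed \<gamma> F u - relaxed \<gamma> F v) \<le> snorm M (u - v))
    \<and> (\<forall>z\<in>W. F z = z)"
    using assms(11)
  proof (elim disjE conjE)
    assume ex: "exact_assms f g A \<sigma> P Q" and F: "F = exact_map f g A b \<sigma> P Q"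
      and \<gamma>: "-1 < \<gamma>" "\<gamma> \<le> 1"
    have psd: "\<And>u. 0 \<le> inner u (block_op P Q A u)" and Q: "invertible Q"
      using ex pos_def_invertible by (auto simp: exact_assms_def)
    \<comment> \<open>With Lipschitz constant \<open>0\<close> the bound on the forward step only
      asks that \<open>(1 - \<gamma>) * inner u (M u)\<close> be nonnegative, so
      \<open>\<gamma> = 1\<close> is allowed.\<close>
    have h0: "convex_lipschitz_gradient 0 (\<lambda>_ :: real ^ 'n. 0)"
      by (simp add: convex_lipschitz_gradient_def convex_on_const GDERIV_const lipschitz_on_def)
    note solv = exact_solvable[OF f g(1,3) ex, where b = b]
    have "snorm M (relaxed \<gamma> F u - relaxed \<gamma> F v) \<le> snorm M (u - v)" for u v
      unfolding M_def F exact_map_eq using \<gamma> \<open>\<sigma> \<ge> 0\<close> psd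
      by (intro relaxed_linearized_nonexpansive[OF sym Q solv exact_mono[OF f] h0]) auto
    moreover have "F z = z" if "z \<in> W" for z
      unfolding F exact_map_eq using that unfolding W_def by (rule kkt_set_fixed[OF Q solv])
    ultimately show ?thesis using \<gamma> psd by (auto simp: M_def)
  next
    assume li: "linearized_assms f A b \<sigma> P Q h L\<^sub>h" and F: "F = linearized_map f g A b \<sigma> P Q h"
      and \<gamma>: "-1 < \<gamma>" "\<gamma> < 1 - L\<^sub>h / (2 * lambda_min (schur_compl P Q A))"
    define \<mu> where "\<mu> = lambda_min (schur_compl P Q A)"
    have h: "convex_lipschitz_gradient L\<^sub>h h" and Q: "pos_def Q" and S: "pos_def (schur_compl P Q A)"
      and k: "convex_on UNIV (\<lambda>x. f x - h x + \<sigma> / 2 * (norm (A *v x - b))\<^sup>2)" and \<mu>: "\<mu> > L\<^sub>h / 2"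
      using li by (auto simp: linearized_assms_def \<mu>_def)
    have "0 \<le> L\<^sub>h" using h by (auto simp: convex_lipschitz_gradient_def lipschitz_on_nonneg)
    with \<mu> have \<mu>_pos: "0 < \<mu>" by linarith
    have low: "\<mu> * (norm x)\<^sup>2 \<le> inner (x, y) (block_op P Q A (x, y))" for x y
      using lambda_min_le_Rayleigh[of "schur_compl P Q A" x] S schur_compl_le_block_op[OF Q, of x P A y]
      by (simp add: \<mu>_def pos_def_def)
    have psd: "0 \<le> inner u (block_op P Q A u)" for u
    proof (cases u)
      case (Pair x y)
      have "0 \<le> \<mu> * (norm x)\<^sup>2" using \<mu>_pos by simp
      with low[of x y] Pair show ?thesis by simp
    qed
    \<comment> \<open>The admissible range of \<open>\<gamma>\<close> is used here: the forward step
      loses \<open>L\<^sub>h / 2\<close>, and relaxation leaves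
      \<open>(1 - \<gamma>) * \<mu>\<close> to pay for it.\<close>
    have "L\<^sub>h < 2 * \<mu> * (1 - \<gamma>)"
      using \<gamma>(2) \<mu>_pos by (simp add: field_simps flip: \<mu>_def)
    moreover from this \<open>0 \<le> L\<^sub>h\<close> \<mu>_pos have "0 < 1 - \<gamma>"
      by (smt (verit) mult_nonneg_nonpos)
    ultimately have bound: "L\<^sub>h / 2 * (norm (fst u))\<^sup>2 \<le> (1 - \<gamma>) * inner u (block_op P Q A u)" for u
    proof -
      have "L\<^sub>h / 2 * (norm (fst u))\<^sup>2 \<le> (1 - \<gamma>) * \<mu> * (norm (fst u))\<^sup>2"
        using \<open>L\<^sub>h < 2 * \<mu> * (1 - \<gamma>)\<close> by (intro mult_right_mono) (auto simp: algebra_simps)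
      also have "\<dots> \<le> (1 - \<gamma>) * inner u (block_op P Q A u)"
        using low[of "fst u" "snd u"] \<open>0 < 1 - \<gamma>\<close> by (simp add: mult.assoc)
      finally show ?thesis .
    qed
    note GD = linearized_GDERIV[OF f h]
    \<comment> \<open>At \<open>y = 0\<close> the block form reduces to that of \<open>P\<close>,
      which inherits the lower bound of the Schur complement.\<close>
    have P: "\<mu> * (norm x)\<^sup>2 \<le> inner x (P *v x)" for x
      using low[of x 0] by (simp add: inner_block_op)
    note solv = strongly_monotone_solvable[OF k GD sym(1) P \<mu>_pos g]
    have "snorm M (relaxed \<gamma> F u - relaxed \<gamma> F v) \<le> snorm M (u - v)" for u v
      unfolding M_def F using \<gamma> psd bound
      by (intro relaxed_linearized_nonexpansive[OF sym pos_def_invertible[OF Q] solv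
            convex_on_gradient_mono[OF k GD] h]) auto
    moreover have "F z = z" if "z \<in> W" for z
      unfolding F using that unfolding W_def by (rule kkt_set_fixed[OF pos_def_invertible[OF Q] solv])
    ultimately show ?thesis using \<gamma> psd by (auto simp: M_def)
  qed
  then have \<gamma>: "-1 < \<gamma>" and psd: "\<And>u. 0 \<le> inner u (M u)"
    and S: "\<And>u v. snorm M (relaxed \<gamma> F u - relaxed \<gamma> F v) \<le> snorm M (u - v)"
    and fix_F: "\<And>z. z \<in> W \<Longrightarrow> F z = z" by blast+
  interpret semi_inner M
    unfolding M_def using sym psd[unfolded M_def] by (rule semi_inner_block_op)
  have "2 / (\<alpha> * \<beta> * (1 + \<gamma>)) \<le> real kstar"
    unfolding \<open>kstar = _\<close> by (rule real_nat_ceiling_ge)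
  then have "sdist M (w n 0) W \<le> \<beta> ^ n * sdist M (w 0 0) W" for n
    using restarted_halpern[where F = F and w = w and W = W and m = kstar]
      S fix_F \<open>W \<noteq> {}\<close> \<gamma> \<open>\<alpha> > 0\<close> \<open>0 < \<beta>\<close> assms(16-19) by blast
  then show ?thesis by blast
qed

end
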